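(* Let $\mathbb{F}$ be a field of characteristic $2$. (1) Let $A$ be a Vidinli algebra over $\mathbb{F}$ of dimension at least $3$. Then $A$ is isomorphic to the algebra $\mathcal{A}(V,*,\varphi)$ for some anticommutative algebra $(V,* )$ over $\mathbb{F}$ endowed with a bilinear form $\varphi\colon V\times V\to\mathbb{F}$. (2) Conversely, given any anticommutative algebra $(V,* )$ over $\mathbb{F}$ endowed with a bilinear form $\varphi$, the algebra $\mathcal{A}(V,*,\varphi)$ is a Vidinli algebra, with norm given by $q(\alpha 1+u)=\alpha^2+\varphi(u,u)$ for any $\alpha\in\mathbb{F}$ and $u\in V$. (3) Moreover, given two anticommutative algebras $(V,* )$ and $(W,\diamond)$ over $\mathbb{F}$, endowed with respective bilinear forms $\varphi$ and $\psi$, the Vidinli algebras $\mathcal{A}(V,*,\varphi)$ and $\mathcal{A}(W,\diamond,\psi)$ are isomorphic if and only if there is a linear form $f\in V^*$ such that the triples $(V,*^f,\varphi^f)$ and $(W,\diamond,\psi)$ are isomorphic, that is, there is a linear isomorphism $\Phi\colon V\to W$ such that $$\Phi(u*^f v)=\Phi(u)\diamond\Phi(v),\qquad \varphi^f(u,v)=\psi\bigl(\Phi(u),\Phi(v)\bigr)$$ for any $u,v\in V$.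
   Context: Algebras are not necessarily associative: an algebra over a field $\mathbb{F}$ is a vector space with a bilinear multiplication (of arbitrary dimension). Write $[x,y]=xy-yx$. For a quadratic form $q$, its polar form is denoted by the same letter: $q(x,y)=q(x+y)-q(x)-q(y)$. A conic algebra is a unital algebra $A$ (unity $1$) endowed with a quadratic form $q\colon A\to\mathbb{F}$, called the norm, such that $q(1)=1$ and $x^2-q(x,1)x+q(x)1=0$ for all $x\in A$. A Vidinli algebra is a conic algebra $A$ such that $[A,A]\subseteq\mathbb{F}1$. Isomorphism of Vidinli algebras means isomorphism of algebras. An algebra $(V,* )$ is anticommutative if $v*v=0$ for all $v\in V$. Given an anticommutative algebra $(V,* )$ over $\mathbb{F}$ with a (not necessarily symmetric) bilinear form $\varphi\colon V\times V\to\mathbb{F}$, $\mathcal{A}(V,*,\varphi)$ denotes the unital algebra defined on $\mathbb{F}1\oplus V$ with multiplication $$(\alpha 1+u)(\beta 1+v)=\bigl(\alpha\beta+\varphi(u,v)\bigr)1+\bigl(\alpha v+\beta u+u*v\bigr),\qquad \alpha,\beta\in\mathbb{F},\ u,v\in V.$$ For $f\in V^*$ (the dual space), $*^f$ is the anticommutative multiplication on $V$ given by $u*^f v=u*v+f(u)v+f(v)u$, and $\varphi^f$ is the bilinear form $\varphi^f(u,v)=\varphi(u,v)+f(u)f(v)+f(u*v)$, for $u,v\in V$. *)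

theory Defs
  imports "HOL-Analysis.Product_Vector"
begin

text \<open>
  A vector space over a field is given by a scalar multiplication satisfying
  \<^locale>\<open>vector_space\<close> on some type, together with a subspace of it as carrier.  As the carrier
  may be all of the type, every vector space is covered; the carrier is only needed so that one
  can assert the existence of a vector space of unknown dimension.  All maps below are only
  constrained on the carriers.
\<close>

definition linear_map_on ::
  "('f::field \<Rightarrow> 'a::ab_group_add \<Rightarrow> 'a) \<Rightarrow> 'a set \<Rightarrow> ('f \<Rightarrow> 'b::ab_group_add \<Rightarrow> 'b) \<Rightarrow> ('a \<Rightarrow> 'b) \<Rightarrow> bool"
  where "linear_map_on s V t h \<longleftrightarrow>
    (\<forall>x\<in>V. \<forall>y\<in>V. h (x + y) = h x + h y) \<and> (\<forall>a. \<forall>x\<in>V. h (s a x) = t a (h x))"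

abbreviation linear_form_on ::
  "('f::field \<Rightarrow> 'a::ab_group_add \<Rightarrow> 'a) \<Rightarrow> 'a set \<Rightarrow> ('a \<Rightarrow> 'f) \<Rightarrow> bool"
  where "linear_form_on s V f \<equiv> linear_map_on s V (*) f"

definition bilinear_map_on ::
  "('f::field \<Rightarrow> 'a::ab_group_add \<Rightarrow> 'a) \<Rightarrow> 'a set \<Rightarrow> ('f \<Rightarrow> 'b::ab_group_add \<Rightarrow> 'b) \<Rightarrow>
    ('a \<Rightarrow> 'a \<Rightarrow> 'b) \<Rightarrow> bool"
  where "bilinear_map_on s V t b \<longleftrightarrow>
    (\<forall>x\<in>V. linear_map_on s V t (\<lambda>y. b x y)) \<and> (\<forall>y\<in>V. linear_map_on s V t (\<lambda>x. b x y))"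

abbreviation bilinear_form_on ::
  "('f::field \<Rightarrow> 'a::ab_group_add \<Rightarrow> 'a) \<Rightarrow> 'a set \<Rightarrow> ('a \<Rightarrow> 'a \<Rightarrow> 'f) \<Rightarrow> bool"
  where "bilinear_form_on s V \<phi> \<equiv> bilinear_map_on s V (*) \<phi>"

definition linear_iso_on ::
  "('f::field \<Rightarrow> 'a::ab_group_add \<Rightarrow> 'a) \<Rightarrow> 'a set \<Rightarrow>
    ('f \<Rightarrow> 'b::ab_group_add \<Rightarrow> 'b) \<Rightarrow> 'b set \<Rightarrow> ('a \<Rightarrow> 'b) \<Rightarrow> bool"
  where "linear_iso_on s V t W h \<longleftrightarrow> linear_map_on s V t h \<and> bij_betw h V W"

definition polar :: "('a::ab_group_add \<Rightarrow> 'f::field) \<Rightarrow> 'a \<Rightarrow> 'a \<Rightarrow> 'f"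
  where "polar q x y = q (x + y) - q x - q y"

definition quadratic_form_on ::
  "('f::field \<Rightarrow> 'a::ab_group_add \<Rightarrow> 'a) \<Rightarrow> 'a set \<Rightarrow> ('a \<Rightarrow> 'f) \<Rightarrow> bool"
  where "quadratic_form_on s V q \<longleftrightarrow>
    (\<forall>a. \<forall>x\<in>V. q (s a x) = a\<^sup>2 * q x) \<and> bilinear_form_on s V (polar q)"

text \<open>The library's \<open>dim\<close> is 0 for infinite-dimensional spaces, hence the following.\<close>

definition dim_at_least ::
  "('f::field \<Rightarrow> 'a::ab_group_add \<Rightarrow> 'a) \<Rightarrow> 'a set \<Rightarrow> nat \<Rightarrow> bool"
  where "dim_at_least s V n \<longleftrightarrow>
    (\<exists>B\<subseteq>V. \<not> module.dependent s B \<and> V \<subseteq> module.span s B \<and> (infinite B \<or> n \<le> card B))"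

locale nonassoc_algebra = vector_space scale
  for scale :: "'f::field \<Rightarrow> 'a::ab_group_add \<Rightarrow> 'a" +
  fixes A :: "'a set" and mul :: "'a \<Rightarrow> 'a \<Rightarrow> 'a"
  assumes subspace_carrier: "subspace A"
    and mul_closed: "x \<in> A \<Longrightarrow> y \<in> A \<Longrightarrow> mul x y \<in> A"
    and mul_bilinear: "bilinear_map_on scale A scale mul"

locale anticommutative_algebra = nonassoc_algebra +
  assumes mul_self: "v \<in> A \<Longrightarrow> mul v v = 0"

locale unital_algebra = nonassoc_algebra scale A mul
  for scale :: "'f::field \<Rightarrow> 'a::ab_group_add \<Rightarrow> 'a" and A mul +
  fixes unity :: 'a
  assumes unity_closed: "unity \<in> A"
    and unity_left: "x \<in> A \<Longrightarrow> mul unity x = x"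
    and unity_right: "x \<in> A \<Longrightarrow> mul x unity = x"

locale conic_algebra = unital_algebra scale A mul unity
  for scale :: "'f::field \<Rightarrow> 'a::ab_group_add \<Rightarrow> 'a" and A mul unity +
  fixes q :: "'a \<Rightarrow> 'f"
  assumes norm_quadratic: "quadratic_form_on scale A q"
    and norm_unity: "q unity = 1"
    and norm_equation:
      "x \<in> A \<Longrightarrow> mul x x - scale (polar q x unity) x + scale (q x) unity = 0"

locale vidinli_algebra = conic_algebra +
  assumes commutators:
    "span {mul x y - mul y x | x y. x \<in> A \<and> y \<in> A} \<subseteq> span {unity}"

definition algebra_isomorphic ::
  "('f::field \<Rightarrow> 'a::ab_group_add \<Rightarrow> 'a) \<Rightarrow> 'a set \<Rightarrow> ('a \<Rightarrow> 'a \<Rightarrow> 'a) \<Rightarrow>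
    ('f \<Rightarrow> 'b::ab_group_add \<Rightarrow> 'b) \<Rightarrow> 'b set \<Rightarrow> ('b \<Rightarrow> 'b \<Rightarrow> 'b) \<Rightarrow> bool"
  where "algebra_isomorphic s A mulA t B mulB \<longleftrightarrow>
    (\<exists>h. linear_iso_on s A t B h \<and> (\<forall>x\<in>A. \<forall>y\<in>A. h (mulA x y) = mulB (h x) (h y)))"

text \<open>
  The algebra \<open>\<A>(V,*,\<phi>)\<close> on \<open>\<bbbF>1 \<oplus> V\<close>, where \<open>\<alpha>1 + u\<close> is encoded as the pair \<open>(\<alpha>, u)\<close>.
\<close>

definition adj_carrier :: "'v set \<Rightarrow> ('f \<times> 'v) set"
  where "adj_carrier V = UNIV \<times> V"

definition adj_scale ::
  "('f::field \<Rightarrow> 'v::ab_group_add \<Rightarrow> 'v) \<Rightarrow> 'f \<Rightarrow> 'f \<times> 'v \<Rightarrow> 'f \<times> 'v"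
  where "adj_scale s = module_prod.scale (*) s"

definition adj_mul ::
  "('f::field \<Rightarrow> 'v::ab_group_add \<Rightarrow> 'v) \<Rightarrow> ('v \<Rightarrow> 'v \<Rightarrow> 'v) \<Rightarrow> ('v \<Rightarrow> 'v \<Rightarrow> 'f) \<Rightarrow>
    'f \<times> 'v \<Rightarrow> 'f \<times> 'v \<Rightarrow> 'f \<times> 'v"
  where "adj_mul s m \<phi> = (\<lambda>(\<alpha>, u) (\<beta>, v). (\<alpha> * \<beta> + \<phi> u v, s \<alpha> v + s \<beta> u + m u v))"

definition adj_unity :: "'f::field \<times> 'v::ab_group_add"
  where "adj_unity = (1, 0)"

definition adj_norm :: "('v \<Rightarrow> 'v \<Rightarrow> 'f::field) \<Rightarrow> 'f \<times> 'v \<Rightarrow> 'f"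
  where "adj_norm \<phi> = (\<lambda>(\<alpha>, u). \<alpha>\<^sup>2 + \<phi> u u)"

text \<open>The modified multiplication \<open>*\<^sup>f\<close> and bilinear form \<open>\<phi>\<^sup>f\<close>.\<close>

definition twist_mul ::
  "('f::field \<Rightarrow> 'v::ab_group_add \<Rightarrow> 'v) \<Rightarrow> ('v \<Rightarrow> 'f) \<Rightarrow> ('v \<Rightarrow> 'v \<Rightarrow> 'v) \<Rightarrow> 'v \<Rightarrow> 'v \<Rightarrow> 'v"
  where "twist_mul s f m u v = m u v + s (f u) v + s (f v) u"

definition twist_form ::
  "('v \<Rightarrow> 'f::field) \<Rightarrow> ('v \<Rightarrow> 'v \<Rightarrow> 'v) \<Rightarrow> ('v \<Rightarrow> 'v \<Rightarrow> 'f) \<Rightarrow> 'v \<Rightarrow> 'v \<Rightarrow> 'f"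
  where "twist_form f m \<phi> u v = \<phi> u v + f u * f v + f (m u v)"

end

theory Submission
  imports Defs
begin

text \<open>
  In characteristic 2 commutators are the same as anticommutators \<open>x y + y x\<close>.  Linearizing the
  norm equation of a conic algebra gives
  \<open>x y + y x = q(x,1) y + q(y,1) x - q(x,y) 1\<close>, so in a Vidinli algebra \<open>q(x,1) y + q(y,1) x\<close> is
  always a multiple of the unity.  Once the dimension exceeds 2 this forces \<open>q(x,1) = 0\<close>
  (\<open>trace_eq_0\<close>), and the norm equation then says that every square is a scalar.  Split off
  the unity by an arbitrary linear complement \<open>V\<close> (\<open>scalar_squares_imp_isomorphic_adj\<close>): the
  \<open>V\<close>-component of the product of \<open>V\<close> is anticommutative because squares are scalar, and the
  \<open>\<bbbF>1\<close>-component is an arbitrary bilinear form.  Conversely, \<open>\<A>(V,*,\<phi>)\<close> is a Vidinli algebra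
  (\<open>adj_vidinli_algebra\<close>), as the terms \<open>2\<alpha>u\<close> and \<open>u * v - v * u = 2 (u * v)\<close> vanish.

  The complement is the only choice made.  Every complement of \<open>\<bbbF>1\<close> in \<open>\<A>(V,*,\<phi>)\<close> is the graph
  of a linear form \<open>f\<close> on \<open>V\<close>, and rewriting the product of the elements \<open>f(u) 1 + u\<close> in terms of
  that complement replaces \<open>*\<close> and \<open>\<phi>\<close> by their twists by \<open>f\<close>.  An isomorphism
  \<open>\<A>(V,*,\<phi>) \<rightarrow> \<A>(W,\<diamondop>,\<psi>)\<close> fixes the unity, hence is given by \<open>\<alpha>1 + u \<mapsto> (\<alpha> + f u) 1 + \<Phi> u\<close> for a
  linear form \<open>f\<close> and a linear bijection \<open>\<Phi>\<close>, and it is multiplicative exactly if \<open>\<Phi>\<close> carries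
  the twisted structure to \<open>(\<diamondop>, \<psi>)\<close> (\<open>adj_isomorphicD\<close>, \<open>adj_isomorphicI\<close>).
\<close>

section \<open>Linear maps on a carrier and fields of characteristic 2\<close>

lemma linear_map_onD:
  assumes "linear_map_on s V t h"
  shows "x \<in> V \<Longrightarrow> y \<in> V \<Longrightarrow> h (x + y) = h x + h y"
    and "x \<in> V \<Longrightarrow> h (s a x) = t a (h x)"
  using assms by (auto simp: linear_map_on_def)

lemma bilinear_map_onD:
  assumes "bilinear_map_on s V t b"
  shows "x \<in> V \<Longrightarrow> y \<in> V \<Longrightarrow> z \<in> V \<Longrightarrow> b x (y + z) = b x y + b x z"
    and "x \<in> V \<Longrightarrow> y \<in> V \<Longrightarrow> z \<in> V \<Longrightarrow> b (x + y) z = b x z + b y z"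
    and "x \<in> V \<Longrightarrow> y \<in> V \<Longrightarrow> b x (s a y) = t a (b x y)"
    and "x \<in> V \<Longrightarrow> y \<in> V \<Longrightarrow> b (s a x) y = t a (b x y)"
  using assms by (auto simp: bilinear_map_on_def linear_map_on_def)

lemma bilinear_map_onI:
  assumes "\<And>x y z. x \<in> V \<Longrightarrow> y \<in> V \<Longrightarrow> z \<in> V \<Longrightarrow> b x (y + z) = b x y + b x z"
    and "\<And>x y z. x \<in> V \<Longrightarrow> y \<in> V \<Longrightarrow> z \<in> V \<Longrightarrow> b (x + y) z = b x z + b y z"
    and "\<And>a x y. x \<in> V \<Longrightarrow> y \<in> V \<Longrightarrow> b x (s a y) = t a (b x y)"
    and "\<And>a x y. x \<in> V \<Longrightarrow> y \<in> V \<Longrightarrow> b (s a x) y = t a (b x y)"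
  shows "bilinear_map_on s V t b"
  using assms by (auto simp: bilinear_map_on_def linear_map_on_def)

lemma double_eq_0_CHAR_2:
  assumes "CHAR('f::field) = 2"
  shows "(a :: 'f) + a = 0"
  using uminus_CHAR_2[OF assms, of a] by (metis add.right_inverse)

lemma (in vector_space) uminus_vector_CHAR_2:
  assumes "CHAR('a) = 2"
  shows "- (v :: 'b) = v"
proof -
  have "- v = scale (- 1) v" by simp
  also have "(- 1 :: 'a) = 1" by (rule uminus_CHAR_2[OF assms])
  finally show ?thesis by simp
qed

lemma (in vector_space) double_vector_CHAR_2:
  assumes "CHAR('a) = 2"
  shows "(v :: 'b) + v = 0"
  using uminus_vector_CHAR_2[OF assms, of v] by (metis add.right_inverse)

text \<open>The form is a coordinate function of a basis of \<open>A\<close> that extends \<open>{e}\<close>.\<close>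

lemma (in vector_space) exists_linear_form_eq_1:
  assumes A: "subspace A" and e: "e \<in> A" "e \<noteq> 0"
  obtains l where "linear_form_on scale A l" and "l e = 1"
proof -
  obtain B where B: "{e} \<subseteq> B" "B \<subseteq> A" "independent B" "A \<subseteq> span B"
    using maximal_independent_subset_extend[of "{e}" A] e by auto
  show thesis
  proof (rule that[of "\<lambda>x. representation B x e"])
    show "linear_form_on scale A (\<lambda>x. representation B x e)"
      using B(4) by (auto simp: linear_map_on_def representation_add[OF B(3)]
          representation_scale[OF B(3)] subset_iff)
    show "representation B e e = 1"
      using B(1) by (simp add: representation_basis[OF B(3)])
  qed
qed

section \<open>The algebra \<open>\<A>(V,*,\<phi>)\<close>\<close>

lemma adj_scale_Pair:
  assumes "vector_space s"
  shows "adj_scale s a (b, v) = (a * b, s a v)"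
proof -
  interpret V: vector_space s by fact
  interpret module_prod "(*) :: 'a \<Rightarrow> 'a \<Rightarrow> 'a" s
    by unfold_locales (auto simp: algebra_simps)
  show ?thesis unfolding adj_scale_def by (rule scale_prod)
qed

lemma adj_mul_Pair:
  "adj_mul s m \<phi> (a, u) (b, v) = (a * b + \<phi> u v, s a v + s b u + m u v)"
  by (simp add: adj_mul_def)

lemma mem_adj_carrier [simp]: "(a, u) \<in> adj_carrier V \<longleftrightarrow> u \<in> V"
  by (simp add: adj_carrier_def)

context nonassoc_algebra
begin

lemmas mul_rules = bilinear_map_onD[OF mul_bilinear]

lemma zero_closed: "0 \<in> A"
  using subspace_carrier by (rule subspace_0)

lemma add_closed: "x \<in> A \<Longrightarrow> y \<in> A \<Longrightarrow> x + y \<in> A"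
  using subspace_carrier by (rule subspace_add)

lemma scale_closed: "x \<in> A \<Longrightarrow> scale a x \<in> A"
  using subspace_carrier by (rule subspace_scale)

lemma diff_closed: "x \<in> A \<Longrightarrow> y \<in> A \<Longrightarrow> x - y \<in> A"
  using subspace_carrier by (rule subspace_diff)

lemmas closed = zero_closed add_closed scale_closed mul_closed

lemma mul_zero: "x \<in> A \<Longrightarrow> mul x 0 = 0" "x \<in> A \<Longrightarrow> mul 0 x = 0"
  using mul_rules(3)[of x x 0] mul_rules(4)[of x x 0] by auto

lemma form_zero:
  assumes "bilinear_form_on scale A \<phi>" "x \<in> A"
  shows "\<phi> x 0 = 0" "\<phi> 0 x = 0"
  using bilinear_map_onD(3,4)[OF assms(1) assms(2) assms(2), of 0] by auto

lemma adj_unital_algebra: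
  assumes \<phi>: "bilinear_form_on scale A \<phi>"
  shows "unital_algebra (adj_scale scale) (adj_carrier A) (adj_mul scale mul \<phi>) adj_unity"
proof -
  have vs: "vector_space scale" by unfold_locales
  note sc = adj_scale_Pair[OF vs]
  note \<phi>_rules = bilinear_map_onD[OF \<phi>] form_zero[OF \<phi>]
  interpret P: vector_space "adj_scale scale"
    by unfold_locales
      (auto simp: sc split_paired_all scale_right_distrib scale_left_distrib algebra_simps)
  show ?thesis
  proof unfold_locales
    show "P.subspace (adj_carrier A)"
      by (auto simp: P.subspace_def sc zero_prod_def closed split_paired_all)
    show "bilinear_map_on (adj_scale scale) (adj_carrier A) (adj_scale scale) (adj_mul scale mul \<phi>)"
      by (rule bilinear_map_onI)
        (auto simp: sc adj_mul_Pair split_paired_all \<phi>_rules mul_rules closed algebra_simps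
          scale_right_distrib scale_left_distrib scale_left_commute)
  qed (auto simp: sc adj_mul_Pair adj_unity_def split_paired_all closed mul_zero \<phi>_rules)
qed

end

lemma (in anticommutative_algebra) mul_anticommute:
  assumes "u \<in> A" "v \<in> A"
  shows "mul u v = - mul v u"
proof -
  have "mul (u + v) (u + v) = mul u v + mul v u"
    using assms by (simp add: mul_rules mul_self[OF assms(1)] mul_self[OF assms(2)] closed)
  moreover have "mul (u + v) (u + v) = 0"
    using assms by (simp add: mul_self closed)
  ultimately show ?thesis by (simp add: eq_neg_iff_add_eq_0)
qed

lemma (in anticommutative_algebra) adj_vidinli_algebra:
  assumes char2: "CHAR('a) = 2" and \<phi>: "bilinear_form_on scale A \<phi>"
  shows "vidinli_algebra (adj_scale scale) (adj_carrier A) (adj_mul scale mul \<phi>)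
    adj_unity (adj_norm \<phi>)"
proof -
  have vs: "vector_space scale" by unfold_locales
  note sc = adj_scale_Pair[OF vs]
  note \<phi>_rules = bilinear_map_onD[OF \<phi>] form_zero[OF \<phi>]
  note dbl = double_eq_0_CHAR_2[OF char2] double_vector_CHAR_2[OF char2]
  interpret P: unital_algebra "adj_scale scale" "adj_carrier A" "adj_mul scale mul \<phi>" adj_unity
    by (rule adj_unital_algebra[OF \<phi>])
  \<comment> \<open>The cross terms \<open>2\<alpha>\<beta>\<close> vanish, so the polar form only sees \<open>V\<close>; in particular it is
     zero against the unity.\<close>
  have polar: "polar (adj_norm \<phi>) (a, u) (b, v) = \<phi> u v + \<phi> v u"
    if "u \<in> A" "v \<in> A" for a b u v
    using that dbl(1)[of "a * b"]
    by (simp add: polar_def adj_norm_def \<phi>_rules closed power2_eq_square algebra_simps)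
  show ?thesis
  proof unfold_locales
    show "quadratic_form_on (adj_scale scale) (adj_carrier A) (adj_norm \<phi>)"
      unfolding quadratic_form_on_def
    proof (intro conjI allI ballI)
      show "bilinear_form_on (adj_scale scale) (adj_carrier A) (polar (adj_norm \<phi>))"
        by (rule bilinear_map_onI)
          (auto simp: sc polar split_paired_all \<phi>_rules closed algebra_simps)
    qed (auto simp: adj_norm_def sc \<phi>_rules closed algebra_simps power2_eq_square)
    show "adj_norm \<phi> adj_unity = 1"
      by (simp add: adj_norm_def adj_unity_def \<phi>_rules closed)
    fix x :: "'a \<times> 'b" assume "x \<in> adj_carrier A"
    then obtain a u where x: "x = (a, u)" "u \<in> A" by (cases x) auto
    have "polar (adj_norm \<phi>) x adj_unity = 0"
      using x by (simp add: polar adj_unity_def closed \<phi>_rules)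
    moreover have "adj_mul scale mul \<phi> x x = adj_scale scale (adj_norm \<phi> x) adj_unity"
      using x dbl(2)[of "scale a u"]
      by (simp add: adj_mul_Pair sc adj_unity_def adj_norm_def mul_self power2_eq_square)
    ultimately show "adj_mul scale mul \<phi> x x
        - adj_scale scale (polar (adj_norm \<phi>) x adj_unity) x
        + adj_scale scale (adj_norm \<phi> x) adj_unity = 0"
      using P.double_vector_CHAR_2[OF char2] by simp
  next
    have "adj_mul scale mul \<phi> x y - adj_mul scale mul \<phi> y x \<in> P.span {adj_unity}"
      if carrier: "x \<in> adj_carrier A" "y \<in> adj_carrier A" for x y :: "'a \<times> 'b"
    proof -
      obtain a u b v where xy: "x = (a, u)" "u \<in> A" "y = (b, v)" "v \<in> A"
        using carrier by (cases x; cases y) auto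
      \<comment> \<open>Anticommutativity is commutativity in characteristic 2, so the \<open>V\<close>-component is 0.\<close>
      have "mul u v = mul v u"
        using mul_anticommute[of u v] uminus_vector_CHAR_2[OF char2] xy by simp
      then have "adj_mul scale mul \<phi> x y - adj_mul scale mul \<phi> y x
          = adj_scale scale (\<phi> u v - \<phi> v u) adj_unity"
        using xy by (simp add: adj_mul_Pair sc adj_unity_def)
      then show ?thesis by (simp add: P.span_base P.span_scale)
    qed
    then show "P.span {adj_mul scale mul \<phi> x y - adj_mul scale mul \<phi> y x |x y.
        x \<in> adj_carrier A \<and> y \<in> adj_carrier A} \<subseteq> P.span {adj_unity}"
      by (intro P.span_minimal) auto
  qed
qed

section \<open>Algebras whose squares are scalar\<close>

text \<open>
  A linear form \<open>l\<close> with \<open>l 1 = 1\<close> splits \<open>A = \<bbbF>1 \<oplus> ker l\<close>, and the product of two elements of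
  \<open>ker l\<close> has the components \<open>\<phi> u v = l (u v)\<close> and \<open>u * v = u v - l (u v) 1\<close>.  The square of
  \<open>u \<in> ker l\<close> is scalar, so its component \<open>u * u\<close> vanishes.
\<close>

lemma (in unital_algebra) scalar_squares_imp_isomorphic_adj:
  assumes unity: "unity \<noteq> 0"
    and squares: "\<And>x. x \<in> A \<Longrightarrow> mul x x \<in> span {unity}"
  obtains V star \<phi> where "anticommutative_algebra scale V star"
    and "bilinear_form_on scale V \<phi>"
    and "algebra_isomorphic scale A mul (adj_scale scale) (adj_carrier V) (adj_mul scale star \<phi>)"
proof -
  have vs: "vector_space scale" by unfold_locales
  note sc = adj_scale_Pair[OF vs]
  obtain l where lin: "linear_form_on scale A l" and l1: "l unity = 1"
    using exists_linear_form_eq_1[OF subspace_carrier unity_closed unity] .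
  note l = linear_map_onD[OF lin] l1
  note A = closed diff_closed unity_closed
  have l0: "l 0 = 0" using l(2)[of unity 0] by (simp add: A)
  have l_diff: "l (x - y) = l x - l y" if "x \<in> A" "y \<in> A" for x y
    using l(1)[of "x - y" y] that by (simp add: A)
  define V where "V = {x \<in> A. l x = 0}"
  define p where "p x = x - scale (l x) unity" for x
  define star where "star u v = p (mul u v)" for u v
  define \<phi> where "\<phi> u v = l (mul u v)" for u v
  have VA: "u \<in> V \<Longrightarrow> u \<in> A" for u by (simp add: V_def)
  have pV: "x \<in> A \<Longrightarrow> p x \<in> V" for x
    by (simp add: V_def p_def A l_diff l)
  have p_add: "p (x + y) = p x + p y" if "x \<in> A" "y \<in> A" for x y
    using that by (simp add: p_def l scale_left_distrib)
  have p_scale: "p (scale a x) = scale a (p x)" if "x \<in> A" for a x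
    using that by (simp add: p_def l scale_right_diff_distrib)
  show thesis
  proof (rule that)
    show "anticommutative_algebra scale V star"
    proof unfold_locales
      show "subspace V"
        by (auto simp: subspace_def V_def A l l0)
      show "bilinear_map_on scale V scale star"
        by (rule bilinear_map_onI)
          (auto simp: star_def VA A mul_rules p_add p_scale)
      show "star x y \<in> V" if "x \<in> V" "y \<in> V" for x y
        using that by (simp add: star_def pV VA A)
      show "star v v = 0" if v: "v \<in> V" for v
      proof -
        obtain k where "mul v v = scale k unity"
          using squares[OF VA[OF v]] by (auto simp: span_singleton)
        then show ?thesis by (simp add: star_def p_def l A)
      qed
    qed
    show "bilinear_form_on scale V \<phi>"
      by (rule bilinear_map_onI) (auto simp: \<phi>_def VA A mul_rules l)
    show "algebra_isomorphic scale A mul (adj_scale scale) (adj_carrier V) (adj_mul scale star \<phi>)"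
      unfolding algebra_isomorphic_def linear_iso_on_def
    proof (intro exI[of _ "\<lambda>x. (l x, p x)"] conjI ballI)
      show "linear_map_on scale A (adj_scale scale) (\<lambda>x. (l x, p x))"
        by (simp add: linear_map_on_def sc l p_add p_scale)
      show "bij_betw (\<lambda>x. (l x, p x)) A (adj_carrier V)"
      proof (rule bij_betw_byWitness[where f' = "\<lambda>(a, u). scale a unity + u"])
        show "\<forall>x\<in>A. (case (l x, p x) of (a, u) \<Rightarrow> scale a unity + u) = x"
          by (simp add: p_def)
        show "\<forall>y\<in>adj_carrier V. (l (case y of (a, u) \<Rightarrow> scale a unity + u),
            p (case y of (a, u) \<Rightarrow> scale a unity + u)) = y"
          by (auto simp: V_def p_def l A)
      qed (auto simp: pV VA A)
      fix x y assume xy: "x \<in> A" "y \<in> A"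
      define a u b v where "a = l x" and "u = p x" and "b = l y" and "v = p y"
      have uv: "u \<in> V" "v \<in> V" and "x = scale a unity + u" "y = scale b unity + v"
        using xy by (simp_all add: u_def v_def a_def b_def pV) (simp_all add: p_def)
      then have "mul x y = scale (a * b) unity + (scale a v + scale b u + mul u v)"
        by (simp add: mul_rules VA A unity_left unity_right algebra_simps scale_right_distrib)
      moreover have "p u = u" "p v = v" "l u = 0" "l v = 0"
        using uv by (simp_all add: V_def p_def)
      moreover have "p unity = 0" by (simp add: p_def l)
      ultimately show "(l (mul x y), p (mul x y)) = adj_mul scale star \<phi> (l x, p x) (l y, p y)"
        using uv unfolding a_def[symmetric] b_def[symmetric] u_def[symmetric] v_def[symmetric]
        by (simp add: adj_mul_Pair star_def \<phi>_def l p_add p_scale VA A)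
    qed
  qed
qed

section \<open>Vidinli algebras of dimension at least 3 in characteristic 2\<close>

lemma (in conic_algebra) linearized_norm_equation:
  assumes xy: "x \<in> A" "y \<in> A"
  shows "mul x y + mul y x
    = scale (polar q x unity) y + scale (polar q y unity) x - scale (polar q x y) unity"
proof -
  have bil: "bilinear_form_on scale A (polar q)"
    using norm_quadratic by (simp add: quadratic_form_on_def)
  have t: "polar q (x + y) unity = polar q x unity + polar q y unity"
    by (rule bilinear_map_onD(2)[OF bil xy unity_closed])
  have "q (x + y) = polar q x y + q x + q y" by (simp add: polar_def)
  then have "mul (x + y) (x + y) - scale (polar q x unity + polar q y unity) (x + y)
      + scale (polar q x y + q x + q y) unity = 0"
    using norm_equation[of "x + y"] t xy by (simp add: closed)
  moreover have "mul (x + y) (x + y) = mul x x + mul y y + (mul x y + mul y x)"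
    using xy by (simp add: mul_rules closed algebra_simps)
  moreover have "mul x x = scale (polar q x unity) x - scale (q x) unity"
    "mul y y = scale (polar q y unity) y - scale (q y) unity"
    using norm_equation[OF xy(1)] norm_equation[OF xy(2)] by (simp_all add: algebra_simps)
  ultimately show ?thesis
    by (simp add: algebra_simps eq_neg_iff_add_eq_0)
qed

text \<open>
  In characteristic 2 the left side of the linearized equation is the commutator \<open>[x,y] \<in> \<bbbF>1\<close>.
  If the trace \<open>q(x,1)\<close> were nonzero, every \<open>y\<close> would therefore lie in the span of \<open>1\<close> and \<open>x\<close>.
\<close>

lemma (in vidinli_algebra) trace_eq_0:
  assumes char2: "CHAR('a) = 2" and dim3: "dim_at_least scale A 3" and x: "x \<in> A"
  shows "polar q x unity = 0"
proof (rule ccontr)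
  assume t: "polar q x unity \<noteq> 0"
  have "y \<in> span {unity, x}" if y: "y \<in> A" for y
  proof -
    let ?S = "span {unity, x}"
    have "mul x y - mul y x \<in> span {unity}"
      using commutators x y by (blast intro: span_base)
    then have "mul x y + mul y x \<in> ?S"
      using uminus_vector_CHAR_2[OF char2, of "mul y x"] span_mono[of "{unity}" "{unity, x}"]
      by (metis diff_minus_eq_add empty_subsetI insert_mono subsetD minus_minus)
    moreover have "scale (polar q x unity) y = mul x y + mul y x - scale (polar q y unity) x
        + scale (polar q x y) unity"
      using linearized_norm_equation[OF x y] by simp
    moreover have "unity \<in> ?S" "x \<in> ?S" by (auto intro: span_base)
    ultimately have "scale (polar q x unity) y \<in> ?S"
      by (simp add: span_add span_diff span_scale)
    then have "scale (inverse (polar q x unity)) (scale (polar q x unity) y) \<in> ?S"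
      by (rule span_scale)
    then show ?thesis using t by simp
  qed
  moreover obtain B where B: "B \<subseteq> A" "independent B" "infinite B \<or> 3 \<le> card B"
    using dim3 by (auto simp: dim_at_least_def)
  ultimately have "finite B \<and> card B \<le> card {unity, x}"
    by (intro independent_span_bound) auto
  moreover have "card {unity, x} \<le> 2" by (simp add: card_insert_if)
  ultimately show False using B(3) by auto
qed

lemma (in vidinli_algebra) isomorphic_adj:
  assumes "CHAR('a) = 2" and "dim_at_least scale A 3"
  obtains V star \<phi> where "anticommutative_algebra scale V star"
    and "bilinear_form_on scale V \<phi>"
    and "algebra_isomorphic scale A mul (adj_scale scale) (adj_carrier V) (adj_mul scale star \<phi>)"
proof (rule scalar_squares_imp_isomorphic_adj)
  have q0: "q 0 = 0"
    using norm_quadratic zero_closed unfolding quadratic_form_on_def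
    by (metis mult_zero_left scale_zero_left zero_power2)
  then show "unity \<noteq> 0" using norm_unity by auto
  show "mul x x \<in> span {unity}" if "x \<in> A" for x
  proof -
    have "mul x x = scale (- q x) unity"
      using norm_equation[OF that] trace_eq_0[OF assms that] by (simp add: eq_neg_iff_add_eq_0)
    then show ?thesis unfolding span_singleton by (rule range_eqI)
  qed
qed (rule that, assumption+)

section \<open>Isomorphisms between the algebras \<open>\<A>(V,*,\<phi>)\<close>\<close>

text \<open>\<open>h e\<close> is a left identity of \<open>B\<close> by surjectivity, and a left identity equals a right one.\<close>

lemma surjective_multiplicative_map_unity:
  assumes "unital_algebra s A m e" and "unital_algebra t B n d"
    and surj: "h ` A = B" and mult: "\<And>x y. x \<in> A \<Longrightarrow> y \<in> A \<Longrightarrow> h (m x y) = n (h x) (h y)"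
  shows "h e = d"
proof -
  interpret A: unital_algebra s A m e by fact
  interpret B: unital_algebra t B n d by fact
  obtain c where c: "c \<in> A" "h c = d" using B.unity_closed surj by force
  have "h e = n (h e) d" using surj A.unity_closed by (auto simp: B.unity_right)
  also have "\<dots> = h (m e c)" using mult[OF A.unity_closed c(1)] c(2) by simp
  also have "\<dots> = d" using c by (simp add: A.unity_left)
  finally show ?thesis .
qed

text \<open>
  An isomorphism fixes the unity, so it is determined by its values \<open>f u + \<Phi> u\<close> on \<open>V\<close>.
  Comparing the components of the image of \<open>u v\<close> with those of \<open>(f u + \<Phi> u) (f v + \<Phi> v)\<close> gives
  \<open>\<Phi> (u * v) = f u \<Phi> v + f v \<Phi> u + \<Phi> u \<diamondop> \<Phi> v\<close> and
  \<open>\<phi> u v + f (u * v) = f u f v + \<psi> (\<Phi> u) (\<Phi> v)\<close>, which are the twisted identities because signs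
  do not matter in characteristic 2.
\<close>

lemma adj_isomorphicD:
  fixes sV :: "'f::field \<Rightarrow> 'v::ab_group_add \<Rightarrow> 'v" and sW :: "'f \<Rightarrow> 'w::ab_group_add \<Rightarrow> 'w"
  assumes char2: "CHAR('f) = 2"
    and V: "nonassoc_algebra sV V star" and \<phi>: "bilinear_form_on sV V \<phi>"
    and W: "nonassoc_algebra sW W diamond" and \<psi>: "bilinear_form_on sW W \<psi>"
    and iso: "algebra_isomorphic
      (adj_scale sV) (adj_carrier V) (adj_mul sV star \<phi>)
      (adj_scale sW) (adj_carrier W) (adj_mul sW diamond \<psi>)"
  obtains f \<Phi> where "linear_form_on sV V f" and "linear_iso_on sV V sW W \<Phi>"
    and "\<And>u v. u \<in> V \<Longrightarrow> v \<in> V \<Longrightarrow> \<Phi> (twist_mul sV f star u v) = diamond (\<Phi> u) (\<Phi> v)"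
    and "\<And>u v. u \<in> V \<Longrightarrow> v \<in> V \<Longrightarrow> twist_form f star \<phi> u v = \<psi> (\<Phi> u) (\<Phi> v)"
proof -
  interpret V: nonassoc_algebra sV V star by fact
  interpret W: nonassoc_algebra sW W diamond by fact
  note scV = adj_scale_Pair[OF V.vector_space_axioms]
  note scW = adj_scale_Pair[OF W.vector_space_axioms]
  note dbl = double_eq_0_CHAR_2[OF char2] W.double_vector_CHAR_2[OF char2]
  obtain h where lin: "linear_map_on (adj_scale sV) (adj_carrier V) (adj_scale sW) h"
    and bij: "bij_betw h (adj_carrier V) (adj_carrier W)"
    and mult: "\<And>x y. x \<in> adj_carrier V \<Longrightarrow> y \<in> adj_carrier V \<Longrightarrow>
      h (adj_mul sV star \<phi> x y) = adj_mul sW diamond \<psi> (h x) (h y)"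
    using iso by (auto simp: algebra_isomorphic_def linear_iso_on_def)
  have surj: "h ` adj_carrier V = adj_carrier W" by (rule bij_betw_imp_surj_on[OF bij])
  have "h adj_unity = adj_unity"
  proof (rule surjective_multiplicative_map_unity[where h = h,
        OF V.adj_unital_algebra[OF \<phi>] W.adj_unital_algebra[OF \<psi>] surj])
    show "h (adj_mul sV star \<phi> x y) = adj_mul sW diamond \<psi> (h x) (h y)"
      if "x \<in> adj_carrier V" "y \<in> adj_carrier V" for x y
      using that by (rule mult)
  qed
  then have h1: "h (1, 0) = (1, 0)" by (simp add: adj_unity_def)
  define f where "f u = fst (h (0, u))" for u
  define \<Phi> where "\<Phi> u = snd (h (0, u))" for u
  have h0: "h (0, u) = (f u, \<Phi> u)" for u by (simp add: f_def \<Phi>_def)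
  have h: "h (a, u) = (a + f u, \<Phi> u)" if "u \<in> V" for a u
  proof -
    have "h (a, u) = h (adj_scale sV a (1, 0) + (0, u))" by (simp add: scV)
    also have "\<dots> = adj_scale sW a (h (1, 0)) + h (0, u)"
      using that linear_map_onD(1)[OF lin, of "(a, 0)" "(0, u)"]
        linear_map_onD(2)[OF lin, of "(1, 0)" a] by (simp add: scV V.closed)
    finally show ?thesis by (simp add: h0 h1 scW)
  qed
  have \<Phi>W: "\<Phi> u \<in> W" if "u \<in> V" for u
    using bij_betwE[OF bij] that h0[of u] mem_adj_carrier by metis
  have add: "f (u + v) = f u + f v" "\<Phi> (u + v) = \<Phi> u + \<Phi> v" if "u \<in> V" "v \<in> V" for u v
    using linear_map_onD(1)[OF lin, of "(0, u)" "(0, v)"] that by (auto simp: h0)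
  have scale: "f (sV a u) = a * f u" "\<Phi> (sV a u) = sW a (\<Phi> u)" if "u \<in> V" for a u
    using linear_map_onD(2)[OF lin, of "(0, u)" a] that by (auto simp: h0 scV scW)
  have prod: "\<phi> u v + f (star u v) = f u * f v + \<psi> (\<Phi> u) (\<Phi> v)"
    "\<Phi> (star u v) = sW (f u) (\<Phi> v) + sW (f v) (\<Phi> u) + diamond (\<Phi> u) (\<Phi> v)"
    if "u \<in> V" "v \<in> V" for u v
    using mult[of "(0, u)" "(0, v)"] that by (auto simp: adj_mul_Pair h V.closed)
  show thesis
  proof (rule that)
    show "linear_form_on sV V f" by (simp add: linear_map_on_def add scale)
    show "linear_iso_on sV V sW W \<Phi>"
      unfolding linear_iso_on_def
    proof (intro conjI bij_betw_imageI)
      show "linear_map_on sV V sW \<Phi>" by (simp add: linear_map_on_def add scale)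
      show "inj_on \<Phi> V"
      proof (rule inj_onI)
        fix u v assume uv: "u \<in> V" "v \<in> V" "\<Phi> u = \<Phi> v"
        \<comment> \<open>The scalar parts can be adjusted so that the images under \<open>h\<close> agree.\<close>
        then have "h (0, u) = h (f u - f v, v)" by (simp add: h)
        then show "u = v"
          using bij_betw_imp_inj_on[OF bij] uv by (auto dest: inj_onD)
      qed
      show "\<Phi> ` V = W"
      proof (intro equalityI subsetI)
        fix w assume "w \<in> W"
        then have "(0, w) \<in> h ` adj_carrier V"
          using bij_betw_imp_surj_on[OF bij] by simp
        then obtain a u where "u \<in> V" "h (a, u) = (0, w)" by auto
        then show "w \<in> \<Phi> ` V" by (auto simp: h)
      qed (auto simp: \<Phi>W)
    qed
    fix u v assume uv: "u \<in> V" "v \<in> V"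
    have "\<Phi> (twist_mul sV f star u v) = diamond (\<Phi> u) (\<Phi> v)
        + (sW (f u) (\<Phi> v) + sW (f u) (\<Phi> v)) + (sW (f v) (\<Phi> u) + sW (f v) (\<Phi> u))"
      using uv by (simp add: twist_mul_def add scale prod V.closed algebra_simps)
    then show "\<Phi> (twist_mul sV f star u v) = diamond (\<Phi> u) (\<Phi> v)" by (simp add: dbl)
    have "twist_form f star \<phi> u v = \<psi> (\<Phi> u) (\<Phi> v) + (f u * f v + f u * f v)"
      using prod(1)[OF uv] by (simp add: twist_form_def algebra_simps)
    then show "twist_form f star \<phi> u v = \<psi> (\<Phi> u) (\<Phi> v)" by (simp add: dbl)
  qed
qed

text \<open>
  The isomorphism is \<open>\<alpha>1 + u \<mapsto> (\<alpha> + f u) 1 + \<Phi> u\<close>.  In the product of two images every term in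
  which \<open>f u\<close> or \<open>f v\<close> occurs beyond what linearity dictates is there twice, hence is 0.
\<close>

lemma adj_isomorphicI:
  fixes sV :: "'f::field \<Rightarrow> 'v::ab_group_add \<Rightarrow> 'v" and sW :: "'f \<Rightarrow> 'w::ab_group_add \<Rightarrow> 'w"
  assumes char2: "CHAR('f) = 2"
    and V: "nonassoc_algebra sV V star" and W: "nonassoc_algebra sW W diamond"
    and f: "linear_form_on sV V f" and \<Phi>: "linear_iso_on sV V sW W \<Phi>"
    and star: "\<And>u v. u \<in> V \<Longrightarrow> v \<in> V \<Longrightarrow>
      \<Phi> (twist_mul sV f star u v) = diamond (\<Phi> u) (\<Phi> v)"
    and form: "\<And>u v. u \<in> V \<Longrightarrow> v \<in> V \<Longrightarrow> twist_form f star \<phi> u v = \<psi> (\<Phi> u) (\<Phi> v)"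
  shows "algebra_isomorphic
      (adj_scale sV) (adj_carrier V) (adj_mul sV star \<phi>)
      (adj_scale sW) (adj_carrier W) (adj_mul sW diamond \<psi>)"
proof -
  interpret V: nonassoc_algebra sV V star by fact
  interpret W: nonassoc_algebra sW W diamond by fact
  note scV = adj_scale_Pair[OF V.vector_space_axioms]
  note scW = adj_scale_Pair[OF W.vector_space_axioms]
  note dbl = double_eq_0_CHAR_2[OF char2] W.double_vector_CHAR_2[OF char2]
  have lin: "linear_map_on sV V sW \<Phi>" and bij: "bij_betw \<Phi> V W"
    using \<Phi> by (auto simp: linear_iso_on_def)
  note f = linear_map_onD[OF f] and \<Phi> = linear_map_onD[OF lin]
  define h where "h = (\<lambda>(a, u). (a + f u, \<Phi> u))"
  have h: "h (a, u) = (a + f u, \<Phi> u)" for a u by (simp add: h_def)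
  show ?thesis
    unfolding algebra_isomorphic_def linear_iso_on_def
  proof (intro exI[of _ h] conjI ballI bij_betw_imageI)
    show "linear_map_on (adj_scale sV) (adj_carrier V) (adj_scale sW) h"
      by (auto simp: linear_map_on_def h scV scW f \<Phi> split_paired_all algebra_simps)
    show "inj_on h (adj_carrier V)"
    proof (rule inj_onI, clarify)
      fix a u b v assume "(a, u) \<in> adj_carrier V" "(b, v) \<in> adj_carrier V" "h (a, u) = h (b, v)"
      moreover from this have "u = v"
        using bij_betw_imp_inj_on[OF bij] by (auto simp: h dest: inj_onD)
      ultimately show "a = b \<and> u = v" by (simp add: h)
    qed
    show "h ` adj_carrier V = adj_carrier W"
    proof (intro equalityI subsetI)
      fix y assume y: "y \<in> h ` adj_carrier V"
      then show "y \<in> adj_carrier W" using bij_betwE[OF bij] by (auto simp: h)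
    next
      fix y :: "'f \<times> 'w" assume "y \<in> adj_carrier W"
      then obtain b w where y: "y = (b, w)" "w \<in> W" by (cases y) auto
      then obtain u where u: "u \<in> V" "\<Phi> u = w" using bij_betw_imp_surj_on[OF bij] by auto
      have "y = h (b - f u, u)" using y u by (simp add: h)
      then show "y \<in> h ` adj_carrier V" using u by simp
    qed
    fix x y :: "'f \<times> 'v" assume "x \<in> adj_carrier V" "y \<in> adj_carrier V"
    then obtain a u b v where xy: "x = (a, u)" "y = (b, v)" and uv: "u \<in> V" "v \<in> V"
      by (cases x; cases y) auto
    have "diamond (\<Phi> u) (\<Phi> v) = \<Phi> (star u v) + sW (f u) (\<Phi> v) + sW (f v) (\<Phi> u)"
      using star[OF uv] uv by (simp add: twist_mul_def \<Phi> V.closed)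
    then have snd: "sW (a + f u) (\<Phi> v) + sW (b + f v) (\<Phi> u) + diamond (\<Phi> u) (\<Phi> v)
        = sW a (\<Phi> v) + sW b (\<Phi> u) + \<Phi> (star u v)
          + (sW (f u) (\<Phi> v) + sW (f u) (\<Phi> v)) + (sW (f v) (\<Phi> u) + sW (f v) (\<Phi> u))"
      by (simp add: W.scale_left_distrib algebra_simps)
    have "\<psi> (\<Phi> u) (\<Phi> v) = \<phi> u v + f u * f v + f (star u v)"
      using form[OF uv] by (simp add: twist_form_def)
    then have fst: "(a + f u) * (b + f v) + \<psi> (\<Phi> u) (\<Phi> v)
        = a * b + \<phi> u v + (a * f v + b * f u + f (star u v)) + (f u * f v + f u * f v)"
      by (simp add: algebra_simps)
    show "h (adj_mul sV star \<phi> x y) = adj_mul sW diamond \<psi> (h x) (h y)"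
      using uv unfolding xy adj_mul_Pair h fst snd
      by (simp add: dbl f \<Phi> V.closed)
  qed
qed

section \<open>The classification\<close>

theorem theorem4p4:
  assumes char2: "CHAR('f::field) = 2"
  shows
    "(\<forall>(sA :: 'f \<Rightarrow> 'a::ab_group_add \<Rightarrow> 'a) A mulA unityA qA.
        vidinli_algebra sA A mulA unityA qA \<and> dim_at_least sA A 3 \<longrightarrow>
        (\<exists>(sV :: 'f \<Rightarrow> 'a \<Rightarrow> 'a) V star \<phi>.
          anticommutative_algebra sV V star \<and> bilinear_form_on sV V \<phi> \<and>
          algebra_isomorphic sA A mulA
            (adj_scale sV) (adj_carrier V) (adj_mul sV star \<phi>)))
   \<and> (\<forall>(sV :: 'f \<Rightarrow> 'v::ab_group_add \<Rightarrow> 'v) V star \<phi>.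
        anticommutative_algebra sV V star \<and> bilinear_form_on sV V \<phi> \<longrightarrow>
        vidinli_algebra (adj_scale sV) (adj_carrier V) (adj_mul sV star \<phi>)
          adj_unity (adj_norm \<phi>))
   \<and> (\<forall>(sV :: 'f \<Rightarrow> 'v \<Rightarrow> 'v) V star \<phi> (sW :: 'f \<Rightarrow> 'w::ab_group_add \<Rightarrow> 'w) W diamond \<psi>.
        anticommutative_algebra sV V star \<and> bilinear_form_on sV V \<phi> \<and>
        anticommutative_algebra sW W diamond \<and> bilinear_form_on sW W \<psi> \<longrightarrow>
        (algebra_isomorphic
            (adj_scale sV) (adj_carrier V) (adj_mul sV star \<phi>)
            (adj_scale sW) (adj_carrier W) (adj_mul sW diamond \<psi>) \<longleftrightarrow>
         (\<exists>f. linear_form_on sV V f \<and>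
           (\<exists>\<Phi>. linear_iso_on sV V sW W \<Phi> \<and>
             (\<forall>u\<in>V. \<forall>v\<in>V.
               \<Phi> (twist_mul sV f star u v) = diamond (\<Phi> u) (\<Phi> v) \<and>
               twist_form f star \<phi> u v = \<psi> (\<Phi> u) (\<Phi> v))))))"
proof (intro conjI allI impI, goal_cases)
  case (1 sA A mulA unityA qA)
  then interpret vidinli_algebra sA A mulA unityA qA by simp
  show ?case
    using isomorphic_adj[OF char2] 1 by metis
next
  case (2 sV V star \<phi>)
  then show ?case
    using anticommutative_algebra.adj_vidinli_algebra[OF _ char2] by blast
next
  case (3 sV V star \<phi> sW W diamond \<psi>)
  then have V: "nonassoc_algebra sV V star" "bilinear_form_on sV V \<phi>"
    and W: "nonassoc_algebra sW W diamond" "bilinear_form_on sW W \<psi>"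
    by (auto simp: anticommutative_algebra_def)
  show ?case (is "?iso \<longleftrightarrow> ?twist")
  proof
    assume ?iso
    then show ?twist
      using adj_isomorphicD[OF char2 V W] by metis
  next
    assume ?twist
    then show ?iso
      using adj_isomorphicI[OF char2 V(1) W(1)] by metis
  qed
qed

end
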